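(* Each of the following infinite products converges (as the limit of its partial products $\prod_{n=n_0}^{N}$ as $N\to\infty$) to the stated value: \begin{enumerate} \item $\displaystyle \frac{\pi}{4}=\prod_{n=0}^{\infty}\frac{8n+2}{8n+3}\cdot\frac{8n+6}{8n+5}\cdot\frac{8n+8}{8n+7}\cdot\frac{8n+8}{8n+9}$ \quad (i.e. $\frac{2}{3}\frac{6}{5}\frac{8}{7}\frac{8}{9}\cdot\frac{10}{11}\frac{14}{13}\frac{16}{15}\frac{16}{17}\cdots$); \item $\displaystyle 2=\prod_{n=0}^{\infty}\frac{8n+2}{8n+1}\cdot\frac{8n+4}{8n+3}\cdot\frac{8n+4}{8n+5}\cdot\frac{8n+6}{8n+7}$ \quad (i.e. $\frac{2}{1}\frac{4}{3}\frac{4}{5}\frac{6}{7}\cdot\frac{10}{9}\frac{12}{11}\frac{12}{13}\frac{14}{15}\cdots$); \item $\displaystyle \frac{\pi}{4\sqrt{2-\sqrt{2}}}=\prod_{n=1}^{\infty}\frac{(8n)^2}{(8n-1)(8n+1)}$; \item $\displaystyle \sqrt{2-\sqrt{2}}=\prod_{n=0}^{\infty}\frac{(8n+2)(8n+6)}{(8n+3)(8n+5)}$; \item $\displaystyle \frac{\pi}{2\sqrt{2+\sqrt{2}}}=\prod_{n=0}^{\infty}\frac{8n+2}{8n+3}\cdot\frac{8n+4}{8n+3}\cdot\frac{8n+4}{8n+5}\cdot\frac{8n+6}{8n+5}\cdot\frac{8n+8}{8n+7}\cdot\frac{8n+8}{8n+9}$; \item $\displaystyle \sqrt{2+\sqrt{2}}=\prod_{n=0}^{\infty}\frac{8n+2}{8n+1}\cdot\frac{8n+6}{8n+7}$;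 \item $\displaystyle \frac{2\pi}{3\sqrt{3}}=\prod_{n=1}^{\infty}\frac{(3n)^2}{(3n-1)(3n+1)}$. \end{enumerate} Moreover, for every integer $K\ge 2$, $$\frac{\pi/K}{\sin(\pi/K)}=\prod_{n=1}^{\infty}\frac{(Kn)^2}{(Kn-1)(Kn+1)}.$$
   Context: All square roots are the positive real square roots. *)

theory Defs
  imports Complex_Main
begin

end

theory Submission
  imports Defs "HOL-Analysis.Gamma_Function" "HOL-Real_Asymp.Real_Asymp"
begin

text \<open>Dividing Euler's product \<open>sin (pi x) = pi x \<Prod>(1 - x^2/n^2)\<close> at two points \<open>a\<close>, \<open>b\<close> and
  regrouping its factors \<open>n - x\<close>, \<open>n + x\<close> as \<open>n + x\<close>, \<open>n + 1 - x\<close> shows that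
  \<open>\<Prod>(n + a)(n + 1 - a) / ((n + b)(n + 1 - b))\<close> tends to \<open>sin (pi a) / sin (pi b)\<close>. All the
  products come from this one and from Euler's product itself at multiples of \<open>1/8\<close>.\<close>

text \<open>The reciprocal of \<open>sin_product_formula_real\<close>. The bounds on
  \<open>x\<close> make \<open>sin (pi * x)\<close> and every \<open>n - x\<close> positive, so the
  limit and each factor may be inverted.\<close>

lemma euler_sine_product:
  fixes x :: real
  assumes "0 < x" "x < 1"
  shows "(\<lambda>N. \<Prod>n=1..N. (real n)\<^sup>2 / ((real n - x) * (real n + x)))
    \<longlonglongrightarrow> (pi * x) / sin (pi * x)"
proof -
  have s: "sin (pi * x) \<noteq> 0"
    using sin_gt_zero[of "pi * x"] assms by (simp add: less_imp_neq)
  have "(\<lambda>N. pi * x / (pi * x * (\<Prod>n=1..N. 1 - x\<^sup>2 / (real n)\<^sup>2))) \<longlonglongrightarrow> pi * x / sin (pi * x)"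
    by (intro tendsto_divide tendsto_const sin_product_formula_real s)
  moreover have "pi * x / (pi * x * (\<Prod>n=1..N. 1 - x\<^sup>2 / (real n)\<^sup>2))
      = (\<Prod>n=1..N. (real n)\<^sup>2 / ((real n - x) * (real n + x)))" for N
  proof -
    have "pi * x / (pi * x * (\<Prod>n=1..N. 1 - x\<^sup>2 / (real n)\<^sup>2))
        = inverse (\<Prod>n=1..N. 1 - x\<^sup>2 / (real n)\<^sup>2)"
      using assms by (simp add: inverse_eq_divide)
    also have "\<dots> = (\<Prod>n=1..N. inverse (1 - x\<^sup>2 / (real n)\<^sup>2))"
      by (simp add: prod_inversef[symmetric] comp_def)
    also have "\<dots> = (\<Prod>n=1..N. (real n)\<^sup>2 / ((real n - x) * (real n + x)))"
    proof (rule prod.cong)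
      fix n assume "n \<in> {1..N}"
      then have "real n - x > 0" "real n > 0" "real n + x > 0" using assms by auto
      then show "inverse (1 - x\<^sup>2 / (real n)\<^sup>2) = (real n)\<^sup>2 / ((real n - x) * (real n + x))"
        by (auto simp: field_simps power2_eq_square)
    qed simp
    finally show ?thesis .
  qed
  ultimately show ?thesis by simp
qed

text \<open>Take \<open>x = 1/k\<close> and expand each fraction by \<open>k\<^sup>2\<close>. The
  cases \<open>k = 8\<close>, \<open>k = 3\<close> and \<open>k = K\<close> are claims of the
  theorem.\<close>

lemma euler_sine_product_scaled:
  fixes k :: real
  assumes "k > 1"
  shows "(\<lambda>N. \<Prod>n=1..N. (k * real n)\<^sup>2 / ((k * real n - 1) * (k * real n + 1)))
    \<longlonglongrightarrow> (pi / k) / sin (pi / k)"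
proof -
  have "(real n)\<^sup>2 / ((real n - 1/k) * (real n + 1/k))
      = (k * real n)\<^sup>2 / ((k * real n - 1) * (k * real n + 1))" for n
  proof -
    have "(k * real n - 1) * (k * real n + 1) = k\<^sup>2 * ((real n - 1/k) * (real n + 1/k))"
      using assms by (simp add: field_simps power2_eq_square)
    then show ?thesis using assms by (simp add: power_mult_distrib)
  qed
  then show ?thesis using euler_sine_product[of "1/k"] assms by simp
qed

text \<open>The factor \<open>n + 1 - x\<close> at index \<open>n\<close> is the factor
  \<open>m - x\<close> at \<open>m = n + 1\<close>. After this shift by one, only \<open>x\<close>
  (from \<open>n = 0\<close>) and \<open>N + 1 - x\<close> (from \<open>n = N\<close>) stay
  unpaired.\<close>

lemma prod_reflection_pair:
  fixes x :: real
  shows "(\<Prod>n=0..N. (real n + x) * (real n + 1 - x))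
    = x * (real N + 1 - x) * (\<Prod>n=1..N. (real n - x) * (real n + x))"
proof (induction N)
  case (Suc N)
  define Q where "Q = (\<Prod>n=1..N. (real n - x) * (real n + x))"
  have "(\<Prod>n=0..Suc N. (real n + x) * (real n + 1 - x))
      = x * (real N + 1 - x) * Q * ((real (Suc N) + x) * (real (Suc N) + 1 - x))"
    using Suc.IH by (simp add: Q_def)
  also have "\<dots> = x * (real (Suc N) + 1 - x) * (Q * ((real (Suc N) - x) * (real (Suc N) + x)))"
    by (simp add: mult_ac)
  finally show ?case by (simp add: Q_def)
qed simp

lemma sine_ratio_product:
  fixes a b :: real
  assumes "0 < a" "a < 1" "0 < b" "b < 1"
  shows "(\<lambda>N. \<Prod>n=0..N. (real n + a) * (real n + 1 - a) / ((real n + b) * (real n + 1 - b)))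
    \<longlonglongrightarrow> sin (pi * a) / sin (pi * b)"
proof -
  define P where "P x N = (\<Prod>n=1..N. (real n)\<^sup>2 / ((real n - x) * (real n + x)))" for x :: real and N
  have sa: "sin (pi * a) > 0" and sb: "sin (pi * b) > 0"
    using assms by (auto intro!: sin_gt_zero)
  \<comment> \<open>The unpaired factors contribute this quotient and the constant
    \<open>a / b\<close>; the latter cancels against \<open>(pi * b) / (pi * a)\<close> from the two
    Euler limits.\<close>
  have "(\<lambda>N. (real N + 1 - a) / (real N + 1 - b)) \<longlonglongrightarrow> 1"
    by real_asymp
  then have "(\<lambda>N. a / b * ((real N + 1 - a) / (real N + 1 - b)) * (P b N / P a N))
      \<longlonglongrightarrow> a / b * 1 * ((pi * b / sin (pi * b)) / (pi * a / sin (pi * a)))"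
    unfolding P_def using assms sa sb
    by (intro tendsto_mult tendsto_divide tendsto_const euler_sine_product) auto
  also have "a / b * 1 * ((pi * b / sin (pi * b)) / (pi * a / sin (pi * a))) = sin (pi * a) / sin (pi * b)"
    using assms sa sb by (simp add: field_simps)
  finally have lim: "(\<lambda>N. a / b * ((real N + 1 - a) / (real N + 1 - b)) * (P b N / P a N))
      \<longlonglongrightarrow> sin (pi * a) / sin (pi * b)" .
  have "a / b * ((real N + 1 - a) / (real N + 1 - b)) * (P b N / P a N)
      = (\<Prod>n=0..N. (real n + a) * (real n + 1 - a) / ((real n + b) * (real n + 1 - b)))" for N
  proof -
    \<comment> \<open>This common numerator of \<open>P b N\<close> and \<open>P a N\<close> cancels
      as a whole, leaving the products that \<open>prod_reflection_pair\<close> produces.\<close>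
    have "(\<Prod>n=1..N. (real n)\<^sup>2) \<noteq> 0" by simp
    then have "P b N / P a N
        = (\<Prod>n=1..N. (real n - a) * (real n + a)) / (\<Prod>n=1..N. (real n - b) * (real n + b))"
      by (simp add: P_def prod_dividef del: prod_zero_iff)
    then show ?thesis
      by (simp add: prod_dividef prod_reflection_pair del: prod.cl_ivl_Suc)
  qed
  then show ?thesis using lim by simp
qed

text \<open>Half-angle formula at \<open>pi / 4\<close>; positivity of the sine selects the
  root.\<close>

lemma sin_pi_eighth: "sin (pi / 8) = sqrt (2 - sqrt 2) / 2"
proof -
  have "cos (pi / 4) = 1 - 2 * (sin (pi / 8))\<^sup>2"
    using cos_double_sin[of "pi / 8"] by simp
  then have "(2 * sin (pi / 8))\<^sup>2 = 2 - sqrt 2"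
    by (simp add: cos_45 power_mult_distrib)
  moreover have "sin (pi / 8) > 0" by (intro sin_gt_zero) auto
  ultimately have "sqrt (2 - sqrt 2) = 2 * sin (pi / 8)"
    by (metis real_sqrt_abs abs_of_pos mult_pos_pos zero_less_numeral)
  then show ?thesis by simp
qed

text \<open>The complementary angle is \<open>pi / 8\<close>, so the half-angle formula for the
  cosine applies.\<close>

lemma sin_three_pi_eighth: "sin (3 * pi / 8) = sqrt (2 + sqrt 2) / 2"
proof -
  have "sin (3 * pi / 8) = cos (pi / 8)"
    using sin_cos_eq[of "3 * pi / 8"] by (simp add: field_simps)
  moreover have "cos (pi / 4) = 2 * (cos (pi / 8))\<^sup>2 - 1"
    using cos_double_cos[of "pi / 8"] by simp
  then have "(2 * cos (pi / 8))\<^sup>2 = 2 + sqrt 2"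
    by (simp add: cos_45 power_mult_distrib)
  moreover have "cos (pi / 8) > 0" by (intro cos_gt_zero) auto
  ultimately show ?thesis
    by (metis real_sqrt_abs abs_of_pos mult_pos_pos zero_less_numeral nonzero_mult_div_cancel_left zero_neq_numeral)
qed

text \<open>Difference of squares: \<open>4 - 2 = 2\<close>. It lets one nested radical in a
  denominator be traded for the other.\<close>

lemma sqrt_two_minus_times_plus: "sqrt (2 - sqrt 2) * sqrt (2 + sqrt 2) = sqrt 2"
  by (simp add: real_sqrt_mult[symmetric] algebra_simps)

text \<open>The sine ratios at \<open>a = 4/8\<close>, \<open>2/8\<close>, \<open>2/8\<close> over
  \<open>b = 3/8\<close>, \<open>3/8\<close>, \<open>1/8\<close>, in this order.\<close>

lemma octant_products:
  shows product_4_4_over_3_5: "(\<lambda>N. \<Prod>n=0..N. (8 * real n + 4) * (8 * real n + 4) / ((8 * real n + 3) * (8 * real n + 5)))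
      \<longlonglongrightarrow> 2 / sqrt (2 + sqrt 2)"
    and product_2_6_over_3_5: "(\<lambda>N. \<Prod>n=0..N. ((8 * real n + 2) * (8 * real n + 6)) / ((8 * real n + 3) * (8 * real n + 5)))
      \<longlonglongrightarrow> sqrt (2 - sqrt 2)"
    and product_2_6_over_1_7: "(\<lambda>N. \<Prod>n=0..N. (8 * real n + 2) * (8 * real n + 6) / ((8 * real n + 1) * (8 * real n + 7)))
      \<longlonglongrightarrow> sqrt (2 + sqrt 2)"
proof -
  \<comment> \<open>Numerator and denominator are both multiplied by 64; the reflection of
    \<open>i/8\<close> to \<open>1 - i/8\<close> becomes that of \<open>i\<close> to
    \<open>8 - i\<close>.\<close>
  have scale: "(real n + i/8) * (real n + 1 - i/8) / ((real n + j/8) * (real n + 1 - j/8))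
      = (8 * real n + i) * (8 * real n + (8 - i)) / ((8 * real n + j) * (8 * real n + (8 - j)))"
    for n and i j :: real
  proof -
    have "(8 * real n + i) * (8 * real n + (8 - i)) = 64 * ((real n + i/8) * (real n + 1 - i/8))" for i
      by (simp add: field_simps)
    then show ?thesis by simp
  qed
  have pos: "sqrt (2 - sqrt 2) > 0" "sqrt (2 + sqrt 2) > 0"
    using sqrt2_less_2 by (auto intro: add_pos_pos)
  \<comment> \<open>These are \<open>sin (pi/4) / sin (3 * pi / 8)\<close> and
    \<open>sin (pi/4) / sin (pi/8)\<close> after the halves cancel.\<close>
  have q: "sqrt 2 / sqrt (2 + sqrt 2) = sqrt (2 - sqrt 2)" "sqrt 2 / sqrt (2 - sqrt 2) = sqrt (2 + sqrt 2)"
    using pos sqrt_two_minus_times_plus by (auto simp: field_simps)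
  show "(\<lambda>N. \<Prod>n=0..N. (8 * real n + 4) * (8 * real n + 4) / ((8 * real n + 3) * (8 * real n + 5)))
      \<longlonglongrightarrow> 2 / sqrt (2 + sqrt 2)"
    using sine_ratio_product[of "4/8" "3/8", unfolded scale]
    by (simp add: sin_three_pi_eighth mult.commute[of pi])
  show "(\<lambda>N. \<Prod>n=0..N. ((8 * real n + 2) * (8 * real n + 6)) / ((8 * real n + 3) * (8 * real n + 5)))
      \<longlonglongrightarrow> sqrt (2 - sqrt 2)"
    using sine_ratio_product[of "2/8" "3/8", unfolded scale]
    by (simp add: sin_three_pi_eighth sin_45 mult.commute[of pi] q)
  show "(\<lambda>N. \<Prod>n=0..N. (8 * real n + 2) * (8 * real n + 6) / ((8 * real n + 1) * (8 * real n + 7)))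
      \<longlonglongrightarrow> sqrt (2 + sqrt 2)"
    using sine_ratio_product[of "2/8" "1/8", unfolded scale]
    by (simp add: sin_pi_eighth sin_45 q)
qed

text \<open>Euler's product for \<open>k = 8\<close>, reindexed to start at 0 so that it can be
  multiplied factor by factor with the octant products.\<close>

lemma product_8_8_over_7_9:
  "(\<lambda>N. \<Prod>n=0..N. (8 * real n + 8) * (8 * real n + 8) / ((8 * real n + 7) * (8 * real n + 9)))
    \<longlonglongrightarrow> pi / (4 * sqrt (2 - sqrt 2))"
proof -
  let ?f = "\<lambda>n. (8 * real n)\<^sup>2 / ((8 * real n - 1) * (8 * real n + 1))"
  \<comment> \<open>The shift pairs the upper limit \<open>N\<close> here with \<open>Suc N\<close>
    in Euler's product; \<open>LIMSEQ_Suc\<close> absorbs the difference.\<close>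
  have "(\<Prod>n=1..Suc N. ?f n)
      = (\<Prod>n=0..N. (8 * real n + 8) * (8 * real n + 8) / ((8 * real n + 7) * (8 * real n + 9)))" for N
    unfolding One_nat_def prod.shift_bounds_cl_Suc_ivl
    by (intro prod.cong) (simp_all add: power2_eq_square algebra_simps)
  then show ?thesis
    using LIMSEQ_Suc[OF euler_sine_product_scaled[of 8]] by (simp add: sin_pi_eighth)
qed

theorem theorem1:
  shows "((\<lambda>N. \<Prod>n=0..N. (8 * real n + 2) / (8 * real n + 3) * ((8 * real n + 6) / (8 * real n + 5))
            * ((8 * real n + 8) / (8 * real n + 7)) * ((8 * real n + 8) / (8 * real n + 9)))
          \<longlonglongrightarrow> pi / 4)
       \<and> ((\<lambda>N. \<Prod>n=0..N. (8 * real n + 2) / (8 * real n + 1) * ((8 * real n + 4) / (8 * real n + 3))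
            * ((8 * real n + 4) / (8 * real n + 5)) * ((8 * real n + 6) / (8 * real n + 7)))
          \<longlonglongrightarrow> 2)
       \<and> ((\<lambda>N. \<Prod>n=1..N. (8 * real n)^2 / ((8 * real n - 1) * (8 * real n + 1)))
          \<longlonglongrightarrow> pi / (4 * sqrt (2 - sqrt 2)))
       \<and> ((\<lambda>N. \<Prod>n=0..N. ((8 * real n + 2) * (8 * real n + 6)) / ((8 * real n + 3) * (8 * real n + 5)))
          \<longlonglongrightarrow> sqrt (2 - sqrt 2))
       \<and> ((\<lambda>N. \<Prod>n=0..N. (8 * real n + 2) / (8 * real n + 3) * ((8 * real n + 4) / (8 * real n + 3))
            * ((8 * real n + 4) / (8 * real n + 5)) * ((8 * real n + 6) / (8 * real n + 5))
            * ((8 * real n + 8) / (8 * real n + 7)) * ((8 * real n + 8) / (8 * real n + 9)))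
          \<longlonglongrightarrow> pi / (2 * sqrt (2 + sqrt 2)))
       \<and> ((\<lambda>N. \<Prod>n=0..N. (8 * real n + 2) / (8 * real n + 1) * ((8 * real n + 6) / (8 * real n + 7)))
          \<longlonglongrightarrow> sqrt (2 + sqrt 2))
       \<and> ((\<lambda>N. \<Prod>n=1..N. (3 * real n)^2 / ((3 * real n - 1) * (3 * real n + 1)))
          \<longlonglongrightarrow> 2 * pi / (3 * sqrt 3))
       \<and> (\<forall>K::int. K \<ge> 2 \<longrightarrow>
          (\<lambda>N. \<Prod>n=1..N. (real_of_int K * real n)^2
                 / ((real_of_int K * real n - 1) * (real_of_int K * real n + 1)))
          \<longlonglongrightarrow> (pi / real_of_int K) / sin (pi / real_of_int K))"
proof (intro conjI allI impI)
  have pos: "sqrt (2 - sqrt 2) > 0" "sqrt (2 + sqrt 2) > 0"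
    using sqrt2_less_2 by (auto intro: add_pos_pos)
  note two_six = product_2_6_over_3_5 and eights = product_8_8_over_7_9
  show "(\<lambda>N. \<Prod>n=0..N. (8 * real n + 2) / (8 * real n + 3) * ((8 * real n + 6) / (8 * real n + 5))
            * ((8 * real n + 8) / (8 * real n + 7)) * ((8 * real n + 8) / (8 * real n + 9)))
          \<longlonglongrightarrow> pi / 4"
    \<comment> \<open>The radical \<open>sqrt (2 - sqrt 2)\<close> cancels between the two
      limits.\<close>
    using tendsto_mult[OF two_six eights] pos
    by (simp add: prod.distrib[symmetric] mult_ac)
  show "(\<lambda>N. \<Prod>n=0..N. (8 * real n + 2) / (8 * real n + 1) * ((8 * real n + 4) / (8 * real n + 3))
            * ((8 * real n + 4) / (8 * real n + 5)) * ((8 * real n + 6) / (8 * real n + 7)))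
          \<longlonglongrightarrow> 2"
    \<comment> \<open>Here \<open>sqrt (2 + sqrt 2)\<close> cancels, leaving 2.\<close>
    using tendsto_mult[OF product_2_6_over_1_7 product_4_4_over_3_5] pos
    by (simp add: prod.distrib[symmetric] mult_ac)
  show "(\<lambda>N. \<Prod>n=1..N. (8 * real n)^2 / ((8 * real n - 1) * (8 * real n + 1)))
          \<longlonglongrightarrow> pi / (4 * sqrt (2 - sqrt 2))"
    using euler_sine_product_scaled[of 8] by (simp add: sin_pi_eighth)
  show "(\<lambda>N. \<Prod>n=0..N. ((8 * real n + 2) * (8 * real n + 6)) / ((8 * real n + 3) * (8 * real n + 5)))
          \<longlonglongrightarrow> sqrt (2 - sqrt 2)"
    by (rule two_six)
  show "(\<lambda>N. \<Prod>n=0..N. (8 * real n + 2) / (8 * real n + 3) * ((8 * real n + 4) / (8 * real n + 3))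
            * ((8 * real n + 4) / (8 * real n + 5)) * ((8 * real n + 6) / (8 * real n + 5))
            * ((8 * real n + 8) / (8 * real n + 7)) * ((8 * real n + 8) / (8 * real n + 9)))
          \<longlonglongrightarrow> pi / (2 * sqrt (2 + sqrt 2))"
    \<comment> \<open>The first two limits multiply to \<open>pi / 4\<close>, and the third supplies
      \<open>2 / sqrt (2 + sqrt 2)\<close>.\<close>
    using tendsto_mult[OF tendsto_mult[OF two_six eights] product_4_4_over_3_5] pos
    by (simp add: prod.distrib[symmetric] mult_ac)
  show "(\<lambda>N. \<Prod>n=0..N. (8 * real n + 2) / (8 * real n + 1) * ((8 * real n + 6) / (8 * real n + 7)))
          \<longlonglongrightarrow> sqrt (2 + sqrt 2)"
    using product_2_6_over_1_7 by simp
  show "(\<lambda>N. \<Prod>n=1..N. (3 * real n)^2 / ((3 * real n - 1) * (3 * real n + 1)))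
          \<longlonglongrightarrow> 2 * pi / (3 * sqrt 3)"
    using euler_sine_product_scaled[of 3] by (simp add: sin_60 mult.commute[of pi])
  show "(\<lambda>N. \<Prod>n=1..N. (real_of_int K * real n)^2
                 / ((real_of_int K * real n - 1) * (real_of_int K * real n + 1)))
          \<longlonglongrightarrow> (pi / real_of_int K) / sin (pi / real_of_int K)"
    if "K \<ge> 2" for K :: int
    using euler_sine_product_scaled[of "real_of_int K"] that by simp
qed

end
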